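(* For large real numbers $x \in \mathbb{R} \setminus \mathbb{N}$, the summatory function of the divisor function satisfies the omega formula $$\sum_{n \le x} d(n) = -\frac{\pi^2}{12} + (\log x + 2\gamma - 1)x + \Omega_{\pm}(x^{1/4}).$$
   Context: $\mathbb{N}=\{0,1,2,3,\ldots\}$. For an integer $n\ge 1$, $d(n)=\#\{d : d \text{ divides } n\}$ is the number of positive divisors of $n$; the sum is over positive integers $n\le x$. $\gamma=0.5772\ldots$ is Euler's constant. For a real function $f$ and a positive function $g$, $f(x)=\Omega_{\pm}(g(x))$ means that $\limsup_{x\to\infty} f(x)/g(x)>0$ and $\liminf_{x\to\infty} f(x)/g(x)<0$; an equation $A(x)=B(x)+\Omega_\pm(g(x))$ means $A(x)-B(x)=\Omega_\pm(g(x))$. *)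

theory Defs
  imports "HOL-Analysis.Analysis"
begin

definition num_divisors :: "nat \<Rightarrow> nat" where
  "num_divisors n = card {d. d dvd n}"

definition divisor_summatory :: "real \<Rightarrow> real" where
  "divisor_summatory x = (\<Sum>n | 1 \<le> n \<and> real n \<le> x. real (num_divisors n))"

(* f = \<Omega>\<^sub>\<plusminus>(g) along the filter F, for g positive along F. The limits are taken
   in the extended reals, since the quotient need not be bounded. *)
definition Omega_pm :: "'a filter \<Rightarrow> ('a \<Rightarrow> real) \<Rightarrow> ('a \<Rightarrow> real) \<Rightarrow> bool" where
  "Omega_pm F f g \<longleftrightarrow>
     Limsup F (\<lambda>x. ereal (f x / g x)) > 0 \<and> Liminf F (\<lambda>x. ereal (f x / g x)) < 0"

(* x tends to infinity through the real numbers that are not natural numbers *)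
definition at_top_non_nat :: "real filter" where
  "at_top_non_nat = inf at_top (principal (- \<nat>))"

end

theory Submission
  imports Defs
begin

text \<open>
  Let \<open>\<psi>(u) = frac u - 1/2\<close>. With \<open>x = t\<^sup>2\<close>, Dirichlet's hyperbola method gives
  the error term \<open>\<Delta>(t\<^sup>2) = - 2 (\<Sum>b\<le>t. \<psi>(t\<^sup>2/b)) + O(1)\<close>; the constant \<open>- \<pi>\<^sup>2/12\<close> is
  absorbed by \<open>O(1)\<close>. Integrate this over \<open>1 \<le> t \<le> N\<close> against the nonnegative weights
  \<open>1 \<plusminus> cos(4\<pi>t)\<close>. In the Fourier series \<open>- \<psi>(u) = (\<Sum>k\<ge>1. sin(2\<pi>ku) / (\<pi>k))\<close> the phases
  \<open>2\<pi>kt\<^sup>2/b + 4\<pi>jt\<close> with \<open>j = 0, 1, -1\<close> have derivative \<open>\<ge> c k\<close> on \<open>t \<ge> b\<close> and contribute only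
  \<open>O(1)\<close> for each \<open>b\<close>, with one exception: for \<open>k = 1\<close>, \<open>j = -1\<close> the phase is \<open>2\<pi>(t - b)\<^sup>2/b\<close>
  modulo \<open>2\<pi>\<close>, stationary at the end point \<open>t = b\<close>, and its integral is at least \<open>c \<surd>b\<close>.
  Hence \<open>\<plusminus> \<integral> \<Delta>(t\<^sup>2) (1 \<plusminus> cos(4\<pi>t)) dt \<ge> c N\<^bsup>3/2\<^esup> - C N\<close> for both signs, which is
  incompatible with a one-sided bound \<open>\<plusminus> \<Delta>(t\<^sup>2) \<le> \<epsilon> \<surd>t + C\<close> for small \<open>\<epsilon>\<close>.
\<close>

subsection \<open>The hyperbola method\<close>


text \<open>The value -1/2 at integers makes \<open>\<lfloor>u\<rfloor> = u - 1/2 - saw u\<close>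
  hold for every \<open>u\<close>. The Fourier series gives 0 there, a difference that integrals do
  not see.\<close>

definition saw :: "real \<Rightarrow> real" where
  "saw u = frac u - 1 / 2"

lemma abs_saw_le: "\<bar>saw u\<bar> \<le> 1 / 2"
  using frac_ge_0[of u] frac_lt_1[of u] unfolding saw_def by linarith

definition saw_sum :: "real \<Rightarrow> real" where
  "saw_sum t = (\<Sum>b = 1..nat \<lfloor>t\<rfloor>. saw (t\<^sup>2 / real b))"

lemma card_multiples_le:
  fixes x :: real and a :: nat
  assumes "0 < a" "0 \<le> x"
  shows "card {b. 1 \<le> b \<and> real (a * b) \<le> x} = nat \<lfloor>x / a\<rfloor>"
proof -
  have "{b. 1 \<le> b \<and> real (a * b) \<le> x} = {1..nat \<lfloor>x / a\<rfloor>}"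
    using assms by (auto simp: le_nat_iff le_floor_iff field_simps)
  then show ?thesis by simp
qed

lemma finite_divisor_pairs:
  fixes x :: real
  shows "finite {(a::nat, b::nat). 1 \<le> a \<and> 1 \<le> b \<and> real (a * b) \<le> x}"
proof (rule finite_subset)
  show "{(a::nat, b::nat). 1 \<le> a \<and> 1 \<le> b \<and> real (a * b) \<le> x} \<subseteq> {..nat \<lfloor>x\<rfloor>} \<times> {..nat \<lfloor>x\<rfloor>}"
  proof clarsimp
    fix a b :: nat
    assume ab: "Suc 0 \<le> a" "Suc 0 \<le> b" "real a * real b \<le> x"
    then have "a * b \<le> nat \<lfloor>x\<rfloor>"
      by (intro le_nat_floor) simp
    moreover have "a \<le> a * b" "b \<le> a * b" using ab by auto
    ultimately show "a \<le> nat \<lfloor>x\<rfloor> \<and> b \<le> nat \<lfloor>x\<rfloor>" by linarith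
  qed
qed auto

text \<open>Sending \<open>(n, a)\<close> with \<open>a dvd n\<close> to \<open>(a, n div a)\<close>
  turns the sum into a count of lattice points under a hyperbola.\<close>

lemma divisor_summatory_eq_card:
  "divisor_summatory x = card {(a::nat, b::nat). 1 \<le> a \<and> 1 \<le> b \<and> real (a * b) \<le> x}"
    (is "_ = real (card ?P)")
proof -
  let ?N = "{n::nat. 1 \<le> n \<and> real n \<le> x}"
  have fN: "finite ?N"
    by (rule finite_subset[of _ "{..nat \<lfloor>x\<rfloor>}"]) (auto intro: le_nat_floor)
  have "bij_betw (\<lambda>(n, a). (a, n div a)) (SIGMA n:?N. {a. a dvd n}) ?P"
    by (rule bij_betw_byWitness[where f' = "\<lambda>(a, b). (a * b, a)"])
       (auto simp: Suc_le_eq elim!: dvdE)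
  then have "card ?P = card (SIGMA n:?N. {a. a dvd n})"
    by (simp add: bij_betw_same_card)
  also have "\<dots> = (\<Sum>n\<in>?N. num_divisors n)"
    unfolding num_divisors_def using fN by (subst card_SigmaI) auto
  finally show ?thesis unfolding divisor_summatory_def by simp
qed

text \<open>A lattice point under the hyperbola has a coordinate at most \<open>t\<close>, so the
  region is a strip together with its mirror image; they overlap exactly in the square of side
  \<open>\<lfloor>t\<rfloor>\<close>, which would be counted twice.\<close>

lemma divisor_summatory_hyperbola:
  assumes "0 \<le> t"
  shows "divisor_summatory (t\<^sup>2) =
    2 * (\<Sum>b = 1..nat \<lfloor>t\<rfloor>. real_of_int \<lfloor>t\<^sup>2 / real b\<rfloor>) - (real (nat \<lfloor>t\<rfloor>))\<^sup>2"
proof -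
  define n where "n = nat \<lfloor>t\<rfloor>"
  have le_n: "a \<le> n \<longleftrightarrow> real a \<le> t" for a
    using assms unfolding n_def by (simp add: le_nat_iff le_floor_iff)
  let ?P = "{(a::nat, b::nat). 1 \<le> a \<and> 1 \<le> b \<and> real (a * b) \<le> t\<^sup>2}"
  let ?L = "{(a::nat, b::nat). a \<in> {1..n} \<and> b \<in> {b. 1 \<le> b \<and> real (a * b) \<le> t\<^sup>2}}"
  let ?R = "prod.swap ` ?L"
  have L: "?L \<subseteq> ?P" by auto
  have R: "?R \<subseteq> ?P" by (auto simp: mult.commute)
  have fin: "finite ?L" "finite ?R"
    using finite_subset[OF L finite_divisor_pairs] by auto
  have "card ?L = card (SIGMA a:{1..n}. {b. 1 \<le> b \<and> real (a * b) \<le> t\<^sup>2})"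
    by (rule arg_cong[where f = card]) auto
  also have "\<dots> = (\<Sum>a\<in>{1..n}. card {b. 1 \<le> b \<and> real (a * b) \<le> t\<^sup>2})"
  proof (rule card_SigmaI)
    show "\<forall>a\<in>{1..n}. finite {b. 1 \<le> b \<and> real (a * b) \<le> t\<^sup>2}"
    proof
      fix a assume "a \<in> {1..n}"
      then show "finite {b. 1 \<le> b \<and> real (a * b) \<le> t\<^sup>2}"
        by (intro finite_subset[OF _ finite_imageI[OF finite_divisor_pairs[of "t\<^sup>2"], of snd]])
           (force simp: image_iff)
    qed
  qed auto
  also have "\<dots> = (\<Sum>a\<in>{1..n}. nat \<lfloor>t\<^sup>2 / a\<rfloor>)"
    by (intro sum.cong refl card_multiples_le) auto
  finally have cL: "real (card ?L) = (\<Sum>b = 1..n. real_of_int \<lfloor>t\<^sup>2 / real b\<rfloor>)"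
    by simp
  have cR: "card ?R = card ?L"
    by (rule card_image) auto
  have un: "?L \<union> ?R = ?P"
  proof (intro equalityI subsetI)
    fix p assume "p \<in> ?P"
    then obtain a b where p: "p = (a, b)" "1 \<le> a" "1 \<le> b" "real a * real b \<le> t\<^sup>2" by auto
    have "real a \<le> t \<or> real b \<le> t"
    proof (rule ccontr)
      assume "\<not> ?thesis"
      then have "t * t < real a * real b"
        using assms by (intro mult_strict_mono) auto
      then show False using p by (simp add: power2_eq_square)
    qed
    then show "p \<in> ?L \<union> ?R"
      using p by (auto simp: le_n image_iff mult.commute)
  qed (use L R in blast)
  have int: "?L \<inter> ?R = {1..n} \<times> {1..n}"
  proof (intro equalityI subsetI)
    fix p assume "p \<in> {1..n} \<times> {1..n}"
    then obtain a b where p: "p = (a, b)" "1 \<le> a" "1 \<le> b" "a \<le> n" "b \<le> n" by auto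
    then have "real a * real b \<le> t * t"
      using assms by (intro mult_mono) (auto simp: le_n)
    then show "p \<in> ?L \<inter> ?R"
      using p by (auto simp: power2_eq_square image_iff mult.commute)
  qed auto
  have "card ?L + card ?R = card ?P + n * n"
    using card_Un_Int[OF fin] unfolding un int by (simp add: card_cartesian_product)
  then have "2 * real (card ?L) = real (card ?P) + (real n)\<^sup>2"
    unfolding cR using of_nat_eq_iff[of "2 * card ?L" "card ?P + n * n", where ?'a = real]
    by (simp add: power2_eq_square)
  then show ?thesis
    unfolding divisor_summatory_eq_card cL n_def[symmetric] by linarith
qed

text \<open>The factor \<open>t\<^sup>2\<close> in front of \<open>harm n\<close> requires
  \<open>harm n\<close> up to O(1/t^2); \<open>e1\<close> and \<open>e2\<close> are remainders of
  that size. They cost 4 and 2, and the fractional part \<open>s\<close> costs at most 2, hence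
  8.\<close>

lemma divisor_summatory_saw_sum:
  assumes "1 \<le> t"
  shows "\<bar>divisor_summatory (t\<^sup>2) - (ln (t\<^sup>2) + 2 * euler_mascheroni - 1) * t\<^sup>2 + 2 * saw_sum t\<bar> \<le> 8"
proof -
  define n where "n = nat \<lfloor>t\<rfloor>"
  define s where "s = t - n"
  have n: "1 \<le> n" using assms by (simp add: n_def le_nat_iff le_floor_iff)
  have s: "0 \<le> s" "s < 1"
    using assms unfolding s_def n_def by linarith+
  have t: "t = n + s" by (simp add: s_def)
  \<comment> \<open>The library bounds confine Euler's constant to an interval with end points
    involving 1/(2n) and 1/(2(n+1)); including 1/(2n) leaves an error O(1/n^2).\<close>
  define e1 where "e1 = harm n - euler_mascheroni - ln (real n + 1) + 1 / (2 * real n)"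
  have "\<bar>e1\<bar> \<le> 1 / (2 * real n) - 1 / (2 * (real n + 1))"
    using euler_mascheroni_bounds[OF n] unfolding e1_def by (simp add: inverse_eq_divide add_ac)
  also have "\<dots> = 1 / (2 * (real n * (real n + 1)))"
    using n by (simp add: divide_simps)
  also have "\<dots> \<le> 1 / (2 * (real n)\<^sup>2)"
    using n by (intro divide_left_mono) (auto simp: power2_eq_square)
  finally have e1: "\<bar>e1\<bar> \<le> 1 / (2 * (real n)\<^sup>2)" .
  have "t \<le> 2 * real n" using t s n by linarith
  then have t4: "t\<^sup>2 \<le> 4 * (real n)\<^sup>2"
    using power_mono[of t "2 * real n" 2] assms by (simp add: power_mult_distrib)
  have "\<bar>2 * t\<^sup>2 * e1\<bar> \<le> 2 * t\<^sup>2 * (1 / (2 * (real n)\<^sup>2))"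
    unfolding abs_mult using e1 by (intro mult_mono) auto
  also have "\<dots> \<le> 4" using t4 n by (simp add: field_simps)
  finally have E1: "\<bar>2 * t\<^sup>2 * e1\<bar> \<le> 4" .
  \<comment> \<open>Since n + 1 = t + (1 - s), this is the second-order remainder of ln(1 + y) at y
    = (1 - s)/t.\<close>
  define e2 where "e2 = ln (real n + 1) - ln t - (1 - s) / t"
  have q: "real n + 1 = t * (1 + (1 - s) / t)" using assms t by (simp add: field_simps)
  have lnq: "ln (real n + 1) = ln t + ln (1 + (1 - s) / t)"
    unfolding q using assms s by (intro ln_mult_pos) (auto intro!: add_pos_nonneg)
  have r: "0 \<le> (1 - s) / t" "(1 - s) / t \<le> 1" using s assms by (auto simp: field_simps)
  have "((1 - s) / t)\<^sup>2 \<le> 1 / t\<^sup>2"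
    using s by (auto simp: power_divide intro!: divide_right_mono power_le_one)
  then have e2: "\<bar>e2\<bar> \<le> 1 / t\<^sup>2"
    unfolding e2_def lnq
    using ln_add_one_self_le_self[OF r(1)] ln_one_plus_pos_lower_bound[OF r] by linarith
  have "\<bar>2 * t\<^sup>2 * e2\<bar> \<le> 2 * t\<^sup>2 * (1 / t\<^sup>2)"
    unfolding abs_mult using e2 by (intro mult_mono) auto
  then have E2: "\<bar>2 * t\<^sup>2 * e2\<bar> \<le> 2" using assms by simp
  have fl: "real_of_int \<lfloor>y\<rfloor> = y - 1 / 2 - saw y" for y
    by (simp add: saw_def frac_def)
  have "(\<Sum>b = 1..n. real_of_int \<lfloor>t\<^sup>2 / real b\<rfloor>) = t\<^sup>2 * harm n - n / 2 - saw_sum t"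
  proof -
    have "(\<Sum>b = 1..n. t\<^sup>2 / real b) = t\<^sup>2 * harm n"
      unfolding harm_def divide_inverse sum_distrib_left ..
    then show ?thesis
      unfolding fl saw_sum_def n_def[symmetric] by (simp add: sum_subtractf)
  qed
  then have D: "divisor_summatory (t\<^sup>2) = 2 * t\<^sup>2 * harm n - n - 2 * saw_sum t - (real n)\<^sup>2"
    using divisor_summatory_hyperbola[of t] assms by (simp add: n_def)
  have hn: "harm n = euler_mascheroni + ln t + (1 - s) / t - 1 / (2 * real n) + e1 + e2"
    unfolding e1_def e2_def by simp
  have lt: "ln (t\<^sup>2) = 2 * ln t" using assms by (simp add: ln_realpow)
  have "divisor_summatory (t\<^sup>2) - (ln (t\<^sup>2) + 2 * euler_mascheroni - 1) * t\<^sup>2 + 2 * saw_sum t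
    = 2 * t\<^sup>2 * ((1 - s) / t - 1 / (2 * real n)) + t\<^sup>2 - n - (real n)\<^sup>2 + 2 * t\<^sup>2 * e1 + 2 * t\<^sup>2 * e2"
    unfolding D lt hn by (simp add: algebra_simps)
  \<comment> \<open>All terms growing with \<open>t\<close> cancel exactly.\<close>
  also have "2 * t\<^sup>2 * ((1 - s) / t - 1 / (2 * real n)) + t\<^sup>2 - n - (real n)\<^sup>2 = - s\<^sup>2 - s\<^sup>2 / n"
  proof -
    have "2 * t\<^sup>2 * ((1 - s) / t - 1 / (2 * real n)) = 2 * t * (1 - s) - t\<^sup>2 / n"
      using assms n by (simp add: field_simps power2_eq_square)
    also have "t\<^sup>2 / n = n + 2 * s + s\<^sup>2 / n"
      using n unfolding t by (simp add: field_simps power2_eq_square)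
    finally show ?thesis unfolding t by (simp add: algebra_simps power2_eq_square)
  qed
  finally have eq: "divisor_summatory (t\<^sup>2) - (ln (t\<^sup>2) + 2 * euler_mascheroni - 1) * t\<^sup>2 + 2 * saw_sum t
    = - s\<^sup>2 - s\<^sup>2 / n + 2 * t\<^sup>2 * e1 + 2 * t\<^sup>2 * e2" .
  have s2: "0 \<le> s\<^sup>2" "s\<^sup>2 \<le> 1" using s by (auto intro: power_le_one)
  have "0 \<le> s\<^sup>2 / n" "s\<^sup>2 / n \<le> 1" using s2 n by (auto simp: field_simps)
  with s2 E1 E2 show ?thesis unfolding eq by linarith
qed


subsection \<open>The Fourier series of the sawtooth\<close>

text \<open>The sum telescopes, since 2 sin(pi u) cos a is the difference of the sines of a + pi u
  and a - pi u.\<close>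

lemma sin_mult_dirichlet_kernel:
  "sin (pi * u) * (1 + 2 * (\<Sum>k = 1..K. cos (2 * pi * real k * u))) = sin ((2 * real K + 1) * pi * u)"
proof (induction K)
  case (Suc K)
  define a where "a = 2 * pi * real (Suc K) * u"
  have a: "(2 * real (Suc K) + 1) * pi * u = a + pi * u" "(2 * real K + 1) * pi * u = a - pi * u"
    by (simp_all add: a_def algebra_simps)
  have "sin (pi * u) * (1 + 2 * (\<Sum>k = 1..Suc K. cos (2 * pi * real k * u)))
    = sin (a - pi * u) + 2 * sin (pi * u) * cos a"
    using Suc.IH unfolding a(2) by (simp add: a_def algebra_simps)
  also have "\<dots> = sin (a + pi * u)" by (simp add: sin_add sin_diff)
  finally show ?case unfolding a(1) .
qed simp

text \<open>The error \<open>f\<close> vanishes at 1/2 and has derivative sin(m pi v)/sin(pi v), so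
  one integration by parts gains the factor 1/m. On \<open>{u..1 / 2}\<close> the sine is
  increasing, which makes \<open>s\<close> its minimum there.\<close>

lemma sawtooth_partial_sum_half:
  assumes u: "0 < u" "u \<le> 1 / 2"
  shows "\<bar>u - 1 / 2 + (\<Sum>k = 1..K. sin (2 * pi * real k * u) / (pi * real k))\<bar>
    \<le> 2 / ((2 * real K + 1) * (sin (pi * u))\<^sup>2)"
proof -
  define m where "m = 2 * real K + 1"
  define s where "s = sin (pi * u)"
  define f where "f v = v - 1 / 2 + (\<Sum>k = 1..K. sin (2 * pi * real k * v) / (pi * real k))" for v
  \<comment> \<open>The added term integrates the oscillating derivative of \<open>f\<close> by parts.\<close>
  define g where "g v = f v + cos (m * pi * v) / (m * pi * sin (pi * v))" for v
  define g' where "g' v = - cos (m * pi * v) * cos (pi * v) / (m * (sin (pi * v))\<^sup>2)" for v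
  have m: "m > 0" by (simp add: m_def add_pos_nonneg)
  have u1: "0 < pi * u" "pi * u \<le> pi / 2"
    using u mult_left_mono[of u "1 / 2" pi] by auto
  have s: "0 < s" "s \<le> 1" using u1 pi_gt_zero by (auto simp: s_def intro!: sin_gt_zero)
  have sv: "s \<le> sin (pi * v)" if "v \<in> {u..1 / 2}" for v
    unfolding s_def
  proof (rule sin_monotone_2pi_le)
    show "pi * u \<le> pi * v" "pi * v \<le> pi / 2"
      using that u mult_left_mono[of v "1 / 2" pi] by auto
  qed (use u1 pi_gt_zero in linarith)
  have der: "(g has_real_derivative g' v) (at v)" if "v \<in> {u..1 / 2}" for v
  proof -
    have sp: "sin (pi * v) \<noteq> 0" using sv[OF that] s by linarith
    have "(f has_real_derivative 1 + 2 * (\<Sum>k = 1..K. cos (2 * pi * real k * v))) (at v)"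
      unfolding f_def
      by (auto intro!: derivative_eq_intros sum.cong simp: sum_distrib_left)
    moreover have "1 + 2 * (\<Sum>k = 1..K. cos (2 * pi * real k * v)) = sin (m * pi * v) / sin (pi * v)"
      using sin_mult_dirichlet_kernel[of v K] sp by (simp add: m_def field_simps)
    ultimately have f': "(f has_real_derivative sin (m * pi * v) / sin (pi * v)) (at v)" by simp
    show ?thesis
      unfolding g_def g'_def using sp m
      by (auto intro!: derivative_eq_intros f' simp: field_simps power2_eq_square)
  qed
  have bnd: "\<bar>g' v\<bar> \<le> 1 / (m * s\<^sup>2)" if "v \<in> {u..1 / 2}" for v
  proof -
    have "\<bar>g' v\<bar> = \<bar>cos (m * pi * v)\<bar> * \<bar>cos (pi * v)\<bar> / (m * (sin (pi * v))\<^sup>2)"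
      using m by (simp add: g'_def abs_mult)
    also have "\<dots> \<le> 1 / (m * s\<^sup>2)"
      using m s sv[OF that] mult_le_one[of "\<bar>cos (m * pi * v)\<bar>" "\<bar>cos (pi * v)\<bar>"]
      by (intro frac_le mult_left_mono power_mono) auto
    finally show ?thesis .
  qed
  have "\<bar>g u - g (1 / 2)\<bar> \<le> 1 / (m * s\<^sup>2) * \<bar>u - 1 / 2\<bar>"
  proof -
    have "norm (g u - g (1 / 2)) \<le> 1 / (m * s\<^sup>2) * norm (u - 1 / 2)"
      by (rule field_differentiable_bound[of "{u..1 / 2}" g g'])
         (use u in \<open>auto intro!: has_field_derivative_at_within[OF der] bnd[simplified]\<close>)
    then show ?thesis by simp
  qed
  also have "\<dots> \<le> 1 / (m * s\<^sup>2) * (1 / 2)"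
    using u m s by (intro mult_left_mono) auto
  finally have 1: "\<bar>g u - g (1 / 2)\<bar> \<le> 1 / (m * s\<^sup>2) / 2" by simp
  have "sin (pi * real k) = 0" for k :: nat
    by (metis sin_npi2)
  then have f2: "f (1 / 2) = 0" by (simp add: f_def)
  \<comment> \<open>\<open>m\<close> is odd, so the boundary term at 1/2 vanishes as well.\<close>
  have "cos (m * pi * (1 / 2)) = 0"
    unfolding cos_zero_iff_int by (intro exI[of _ "2 * int K + 1"]) (auto simp: m_def)
  then have g2: "g (1 / 2) = 0" by (simp add: g_def f2)
  have "\<bar>cos (m * pi * u) / (m * pi * s)\<bar> \<le> 1 / (m * pi * s)"
    using m s by (simp add: abs_mult divide_right_mono)
  also have "\<dots> \<le> 1 / (m * s\<^sup>2)"
  proof (intro divide_left_mono)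
    have "s * s \<le> 1 * s" using s by (intro mult_right_mono) auto
    also have "\<dots> \<le> pi * s" using s pi_gt3 by (intro mult_right_mono) auto
    finally show "m * s\<^sup>2 \<le> m * pi * s" using m by (simp add: power2_eq_square)
  qed (use m s in auto)
  finally have 2: "\<bar>cos (m * pi * u) / (m * pi * s)\<bar> \<le> 1 / (m * s\<^sup>2)" .
  have "\<bar>f u\<bar> \<le> 1 / (m * s\<^sup>2) + 1 / (m * s\<^sup>2)"
  proof -
    have "f u = g u - cos (m * pi * u) / (m * pi * s)" by (simp add: g_def s_def)
    moreover define e where "e = 1 / (m * s\<^sup>2)"
    moreover have "0 \<le> e" using m s by (simp add: e_def)
    ultimately show ?thesis using 1 2 g2 unfolding e_def[symmetric] by linarith
  qed
  then show ?thesis by (simp add: f_def m_def s_def)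
qed

text \<open>The reflection of \<open>u\<close> to \<open>1 - u\<close> negates the error and
  preserves sin(pi u).\<close>

lemma sawtooth_partial_sum:
  assumes u: "0 < u" "u < 1"
  shows "\<bar>u - 1 / 2 + (\<Sum>k = 1..K. sin (2 * pi * real k * u) / (pi * real k))\<bar>
    \<le> 2 / ((2 * real K + 1) * (sin (pi * u))\<^sup>2)"
proof (cases "u \<le> 1 / 2")
  case False
  have "sin (2 * pi * real k * (1 - u)) = - sin (2 * pi * real k * u)" for k :: nat
    using sin_npi2[of "2 * k"] cos_npi2[of "2 * k"]
    by (simp add: right_diff_distrib sin_diff mult_ac)
  then have "(\<Sum>k = 1..K. sin (2 * pi * real k * (1 - u)) / (pi * real k))
    = - (\<Sum>k = 1..K. sin (2 * pi * real k * u) / (pi * real k))"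
    by (simp add: sum_negf)
  moreover have "sin (pi * (1 - u)) = sin (pi * u)"
    by (simp add: right_diff_distrib sin_diff)
  ultimately show ?thesis
    using sawtooth_partial_sum_half[of "1 - u" K] u False by (simp add: abs_le_iff)
qed (use u sawtooth_partial_sum_half in auto)

text \<open>
  Integrating once makes the series converge uniformly, which justifies termwise integration
  across the jumps of \<^const>\<open>saw\<close>.
\<close>

definition saw_primitive_sum :: "nat \<Rightarrow> real \<Rightarrow> real" where
  "saw_primitive_sum K u = (\<Sum>k = 1..K. cos (2 * pi * real k * u) / (2 * (pi * real k)\<^sup>2))"

text \<open>This is half the periodic second Bernoulli function.\<close>

definition saw_primitive :: "real \<Rightarrow> real" where
  "saw_primitive u = (\<Sum>k. cos (2 * pi * real (Suc k) * u) / (2 * (pi * real (Suc k))\<^sup>2))"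

lemma uniform_limit_saw_primitive:
  "uniform_limit UNIV saw_primitive_sum saw_primitive sequentially"
proof -
  have eq: "saw_primitive_sum = (\<lambda>K u. \<Sum>k<K. cos (2 * pi * real (Suc k) * u) / (2 * (pi * real (Suc k))\<^sup>2))"
    unfolding saw_primitive_sum_def
    by (intro ext) (simp add: sum.atLeast1_atMost_eq)
  show ?thesis
    unfolding eq saw_primitive_def
  proof (rule Weierstrass_m_test)
    fix k :: nat and u :: real
    have "1 \<le> pi\<^sup>2" using pi_gt3 by (intro one_le_power) linarith
    then have "1 * (real (Suc k))\<^sup>2 \<le> (2 * pi\<^sup>2) * (real (Suc k))\<^sup>2"
      by (intro mult_right_mono) auto
    then have "norm (cos (2 * pi * real (Suc k) * u) / (2 * (pi * real (Suc k))\<^sup>2)) \<le> 1 / (real (Suc k))\<^sup>2"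
      unfolding real_norm_def abs_divide
      by (intro frac_le) (auto simp: power_mult_distrib)
    then show "norm (cos (2 * pi * real (Suc k) * u) / (2 * (pi * real (Suc k))\<^sup>2)) \<le> inverse ((real (Suc k))\<^sup>2)"
      by (simp add: inverse_eq_divide)
  next
    show "summable (\<lambda>k. inverse ((real (Suc k))\<^sup>2))"
      unfolding summable_Suc_iff[of "\<lambda>n. inverse ((real n)\<^sup>2)"]
      by (intro inverse_power_summable) simp
  qed
qed

lemma saw_primitive_sum_deriv:
  "(saw_primitive_sum K has_real_derivative
     - (\<Sum>k = 1..K. sin (2 * pi * real k * u) / (pi * real k))) (at u)"
  unfolding saw_primitive_sum_def
  by (auto intro!: derivative_eq_intros sum.cong simp: sum_negf[symmetric] power2_eq_square field_simps)

lemma saw_primitive_frac: "saw_primitive (frac u) = saw_primitive u"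
proof -
  have "cos (2 * pi * real (Suc k) * frac u) = cos (2 * pi * real (Suc k) * u)" for k
  proof -
    have "2 * pi * real (Suc k) * u = 2 * pi * real (Suc k) * frac u + 2 * pi * of_int (int (Suc k) * \<lfloor>u\<rfloor>)"
      by (simp add: frac_def algebra_simps)
    then show ?thesis
      using cos_int_2pin[of "int (Suc k) * \<lfloor>u\<rfloor>"] sin_int_2pin[of "int (Suc k) * \<lfloor>u\<rfloor>"]
      by (simp only: cos_add)
  qed
  then show ?thesis by (simp only: saw_primitive_def)
qed

text \<open>The derivative of \<open>h K\<close> is minus the sawtooth error, which is O(1/K)
  uniformly on \<open>{d..1 - d}\<close>; hence \<open>h K u - h K (1 / 2)\<close> tends to 0. The
  summand 1/8 offsets the value -1/8 of (v^2 - v)/2 at v = 1/2.\<close>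

lemma saw_primitive_eq:
  assumes "0 < u" "u < 1"
  shows "saw_primitive u = (u\<^sup>2 - u) / 2 + (saw_primitive (1 / 2) + 1 / 8)"
proof -
  define h where "h K v = saw_primitive_sum K v - (v\<^sup>2 - v) / 2" for K v
  \<comment> \<open>The symmetric interval \<open>{d..1 - d}\<close> contains both \<open>u\<close>
    and 1/2, and sin(pi v) is at least sin(pi d) on it.\<close>
  define d where "d = min u (1 - u)"
  define s where "s = sin (pi * d)"
  have d: "0 < d" "d \<le> 1 / 2" using assms unfolding d_def by (auto simp: min_def)
  have pid: "0 < pi * d" "pi * d \<le> pi / 2" using d mult_left_mono[of d "1 / 2" pi] by auto
  have s: "0 < s" using pid pi_gt_zero by (auto simp: s_def intro!: sin_gt_zero)
  have sv: "s \<le> sin (pi * v)" if "v \<in> {d..1 - d}" for v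
  proof (cases "v \<le> 1 / 2")
    case True
    then have "pi * d \<le> pi * v" "pi * v \<le> pi / 2"
      using that mult_left_mono[of v "1 / 2" pi] by auto
    then show ?thesis
      unfolding s_def using pid pi_gt_zero by (intro sin_monotone_2pi_le) linarith+
  next
    case False
    then have "pi * d \<le> pi * (1 - v)" "pi * (1 - v) \<le> pi / 2"
      using that mult_left_mono[of "1 - v" "1 / 2" pi] by auto
    then have "sin (pi * d) \<le> sin (pi * (1 - v))"
      using pid pi_gt_zero by (intro sin_monotone_2pi_le) linarith+
    then show ?thesis unfolding s_def by (simp add: right_diff_distrib sin_diff)
  qed
  have "\<bar>h K u - h K (1 / 2)\<bar> \<le> 2 / ((2 * real K + 1) * s\<^sup>2) * \<bar>u - 1 / 2\<bar>" for K
  proof -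
    let ?D = "\<lambda>v. - (v - 1 / 2 + (\<Sum>k = 1..K. sin (2 * pi * real k * v) / (pi * real k)))"
    have "(h K has_real_derivative ?D v) (at v)" for v
    proof -
      have "((\<lambda>v. (v\<^sup>2 - v) / 2) has_real_derivative v - 1 / 2) (at v)"
        by (auto intro!: derivative_eq_intros simp: field_simps)
      from DERIV_diff[OF saw_primitive_sum_deriv[of K v] this] show ?thesis
        unfolding h_def by (rule DERIV_cong) linarith
    qed
    moreover have "\<bar>?D v\<bar> \<le> 2 / ((2 * real K + 1) * s\<^sup>2)" if "v \<in> {d..1 - d}" for v
    proof -
      have "\<bar>?D v\<bar> \<le> 2 / ((2 * real K + 1) * (sin (pi * v))\<^sup>2)"
        unfolding abs_minus_cancel using that d by (intro sawtooth_partial_sum) auto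
      also have "\<dots> \<le> 2 / ((2 * real K + 1) * s\<^sup>2)"
        using s sv[OF that] by (intro divide_left_mono mult_left_mono power_mono mult_pos_pos) auto
      finally show ?thesis .
    qed
    ultimately have "norm (h K u - h K (1 / 2)) \<le> 2 / ((2 * real K + 1) * s\<^sup>2) * norm (u - 1 / 2)"
      using d assms
      by (intro field_differentiable_bound[of "{d..1 - d}" "h K" ?D])
         (simp_all only: real_norm_def has_field_derivative_at_within convex_real_interval,
          auto simp: d_def)
    then show ?thesis by simp
  qed
  moreover have "(\<lambda>K. 2 / ((2 * real K + 1) * s\<^sup>2) * \<bar>u - 1 / 2\<bar>) \<longlonglongrightarrow> 0"
  proof -
    have "filterlim (\<lambda>K. 2 * real K + 1) at_top sequentially"
      by (rule filterlim_at_top_mono[OF filterlim_real_sequentially]) (simp add: eventually_sequentially)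
    then have "(\<lambda>K. inverse (2 * real K + 1)) \<longlonglongrightarrow> 0"
      by (rule tendsto_inverse_0_at_top)
    then have "(\<lambda>K. inverse (2 * real K + 1) * (2 / s\<^sup>2 * \<bar>u - 1 / 2\<bar>)) \<longlonglongrightarrow> 0"
      by (rule tendsto_mult_left_zero)
    moreover have "inverse (2 * real K + 1) * (2 / s\<^sup>2 * \<bar>u - 1 / 2\<bar>)
        = 2 / ((2 * real K + 1) * s\<^sup>2) * \<bar>u - 1 / 2\<bar>" for K
      by (simp add: inverse_eq_divide)
    ultimately show ?thesis by (simp only:)
  qed
  ultimately have lim0: "(\<lambda>K. h K u - h K (1 / 2)) \<longlonglongrightarrow> 0"
    by (intro Lim_null_comparison[where f = "\<lambda>K. h K u - h K (1 / 2)"] always_eventually) auto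
  have "(\<lambda>K. saw_primitive_sum K v) \<longlonglongrightarrow> saw_primitive v" for v
    using tendsto_uniform_limitI[OF uniform_limit_saw_primitive] by blast
  then have "(\<lambda>K. h K u - h K (1 / 2)) \<longlonglongrightarrow>
      (saw_primitive u - (u\<^sup>2 - u) / 2) - (saw_primitive (1 / 2) - ((1 / 2)\<^sup>2 - 1 / 2) / 2)"
    unfolding h_def by (intro tendsto_intros)
  from LIMSEQ_unique[OF this lim0] show ?thesis by (simp add: power2_eq_square)
qed

text \<open>By periodicity the quadratic formula, shifted by \<open>\<lfloor>u\<rfloor>\<close>,
  holds on the whole open unit interval around \<open>u\<close>.\<close>

lemma saw_primitive_deriv:
  assumes "u \<notin> \<int>"
  shows "(saw_primitive has_real_derivative saw u) (at u)"
proof -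
  let ?n = "real_of_int \<lfloor>u\<rfloor>"
  let ?c = "saw_primitive (1 / 2) + 1 / 8"
  have u: "?n < u" "u < ?n + 1"
    using assms by (auto simp: floor_less_iff intro: le_neq_trans)
      (metis Ints_of_int of_int_floor_le order_le_less)
  have "((\<lambda>v. ((v - ?n)\<^sup>2 - (v - ?n)) / 2 + ?c) has_real_derivative saw u) (at u)"
    by (auto intro!: derivative_eq_intros simp: saw_def frac_def)
  then show ?thesis
  proof (rule has_field_derivative_transform_within_open)
    show "open {?n<..<?n + 1}" "u \<in> {?n<..<?n + 1}" using u by auto
    fix v assume v: "v \<in> {?n<..<?n + 1}"
    then have "\<lfloor>v\<rfloor> = \<lfloor>u\<rfloor>" by (auto intro: floor_unique)
    then have fr: "frac v = v - ?n" by (simp add: frac_def)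
    show "((v - ?n)\<^sup>2 - (v - ?n)) / 2 + ?c = saw_primitive v"
      using saw_primitive_eq[of "frac v"] saw_primitive_frac[of v] v unfolding fr by simp
  qed
qed

text \<open>Continuity also at the integers lets the fundamental theorem of calculus pass over the
  jumps of \<open>saw\<close>.\<close>

lemma continuous_on_saw_primitive: "continuous_on A saw_primitive"
proof -
  have "continuous_on UNIV saw_primitive"
    by (rule uniform_limit_theorem[OF _ uniform_limit_saw_primitive])
       (auto intro!: always_eventually continuous_on_sum continuous_on_divide continuous_on_cos
         continuous_on_mult continuous_on_const continuous_on_id simp: saw_primitive_sum_def[abs_def])
  then show ?thesis by (rule continuous_on_subset) auto
qed


subsection \<open>Integrals with a quadratic phase\<close>

text \<open>
  If \<open>f\<close> has increasing positive derivative, then \<open>(1 - cos f) / f'\<close> grows at most as fast, and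
  \<open>- (1 + cos f) / f'\<close> at least as fast, as a primitive of \<open>sin f\<close>.
\<close>

lemma integral_sin_quadratic_bound:
  fixes a c \<alpha> \<beta> :: real
  assumes "0 \<le> \<alpha>" "a \<le> c" "0 < 2 * \<alpha> * a + \<beta>"
  shows "\<bar>integral {a..c} (\<lambda>t. sin (\<alpha> * t\<^sup>2 + \<beta> * t))\<bar> \<le> 2 / (2 * \<alpha> * a + \<beta>)"
proof -
  define p where "p t = 2 * \<alpha> * t + \<beta>" for t
  define f where "f t = \<alpha> * t\<^sup>2 + \<beta> * t" for t
  have p: "p a \<le> p t" "0 < p t" if "t \<in> {a..c}" for t
  proof -
    show "p a \<le> p t" using that assms(1) by (auto simp: p_def mult_left_mono)
    then show "0 < p t" using assms(3) unfolding p_def by linarith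
  qed
  have der: "(f has_real_derivative p t) (at t within X)" "(p has_real_derivative 2 * \<alpha>) (at t within X)" for t X
    unfolding f_def p_def by (auto intro!: derivative_eq_intros)
  have F: "((\<lambda>t. sin (f t)) has_integral integral {a..c} (\<lambda>t. sin (f t))) {a..c}"
    unfolding f_def by (intro integrable_integral integrable_continuous_interval continuous_intros)
  have U: "((\<lambda>t. sin (f t) + 2 * \<alpha> * (1 + cos (f t)) / (p t)\<^sup>2) has_integral
      (- (1 + cos (f c)) / p c) - (- (1 + cos (f a)) / p a)) {a..c}"
    using \<open>a \<le> c\<close>
  proof (rule fundamental_theorem_of_calculus)
    fix t assume "t \<in> {a..c}"
    then have "p t \<noteq> 0" using p(2) by force
    then show "((\<lambda>t. - (1 + cos (f t)) / p t) has_vector_derivative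
        sin (f t) + 2 * \<alpha> * (1 + cos (f t)) / (p t)\<^sup>2) (at t within {a..c})"
      unfolding has_real_derivative_iff_has_vector_derivative[symmetric]
      by (auto intro!: derivative_eq_intros der simp: field_simps power2_eq_square)
  qed
  have L: "((\<lambda>t. sin (f t) - 2 * \<alpha> * (1 - cos (f t)) / (p t)\<^sup>2) has_integral
      (1 - cos (f c)) / p c - (1 - cos (f a)) / p a) {a..c}"
    using \<open>a \<le> c\<close>
  proof (rule fundamental_theorem_of_calculus)
    fix t assume "t \<in> {a..c}"
    then have "p t \<noteq> 0" using p(2) by force
    then show "((\<lambda>t. (1 - cos (f t)) / p t) has_vector_derivative
        sin (f t) - 2 * \<alpha> * (1 - cos (f t)) / (p t)\<^sup>2) (at t within {a..c})"
      unfolding has_real_derivative_iff_has_vector_derivative[symmetric]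
      by (auto intro!: derivative_eq_intros der simp: field_simps power2_eq_square)
  qed
  have cos: "0 \<le> 1 + cos x" "1 + cos x \<le> 2" "0 \<le> 1 - cos x" "1 - cos x \<le> 2" for x :: real
    using cos_ge_minus_one[of x] cos_le_one[of x] by linarith+
  have pa: "0 < p a" and pc: "0 < p c" using p(2) assms(2) by auto
  have "integral {a..c} (\<lambda>t. sin (f t)) \<le> (- (1 + cos (f c)) / p c) - (- (1 + cos (f a)) / p a)"
    using assms(1) cos by (intro has_integral_le[OF F U]) simp
  also have "\<dots> \<le> 2 / p a"
  proof -
    have "0 \<le> (1 + cos (f c)) / p c" "(1 + cos (f a)) / p a \<le> 2 / p a"
      using pa pc cos by (auto intro!: divide_right_mono)
    then show ?thesis unfolding minus_divide_left[symmetric] by linarith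
  qed
  finally have 1: "integral {a..c} (\<lambda>t. sin (f t)) \<le> 2 / p a" .
  have "(1 - cos (f c)) / p c - (1 - cos (f a)) / p a \<le> integral {a..c} (\<lambda>t. sin (f t))"
    using assms(1) cos by (intro has_integral_le[OF L F]) simp
  moreover have "0 \<le> (1 - cos (f c)) / p c" "(1 - cos (f a)) / p a \<le> 2 / p a"
    using pa pc cos by (auto intro!: divide_right_mono)
  ultimately have "- (2 / p a) \<le> integral {a..c} (\<lambda>t. sin (f t))" by linarith
  with 1 show ?thesis by (simp add: f_def p_def)
qed

text \<open>5/6 is 1 - 1/6, from x - x^3/6 and x^3 \<le> x.\<close>

lemma sin_ge_five_sixths:
  fixes x :: real
  assumes "0 \<le> x" "x \<le> 1"
  shows "5 / 6 * x \<le> sin x"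
proof -
  have "\<bar>sin x - x\<bar> \<le> x ^ 3 / 6"
    using Maclaurin_sin_bound[of x 3] assms
    by (simp add: sin_coeff_def eval_nat_numeral inverse_eq_divide)
  moreover have "x ^ 3 \<le> x" using assms power_decreasing[of 1 3 x] by simp
  ultimately show ?thesis by linarith
qed

lemma one_minus_cos_le:
  fixes x :: real
  shows "1 - cos x \<le> x\<^sup>2 / 2"
proof -
  have "\<bar>sin (x / 2)\<bar>\<^sup>2 \<le> \<bar>x / 2\<bar>\<^sup>2"
    by (intro power_mono abs_sin_x_le_abs_x) auto
  then show ?thesis
    using cos_double_sin[of "x / 2"] by (simp add: power_divide)
qed

text \<open>A Fresnel integral, cut at the point \<open>q\<close> where the phase reaches 1. Before
  \<open>q\<close> the integrand is nonnegative, which settles short ranges; beyond \<open>q\<close>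
  a comparison primitive limits the loss. The constant is 5/18 - 1/4 = 1/36.\<close>

lemma integral_sin_square_lower:
  fixes \<kappa> H :: real
  assumes "0 < \<kappa>" "0 \<le> H"
  shows "0 \<le> integral {0..H} (\<lambda>h. sin (\<kappa> * h\<^sup>2))"
    and "1 \<le> sqrt \<kappa> * H \<Longrightarrow> 1 / (36 * sqrt \<kappa>) \<le> integral {0..H} (\<lambda>h. sin (\<kappa> * h\<^sup>2))"
proof -
  define I where "I a c = integral {a..c} (\<lambda>h. sin (\<kappa> * h\<^sup>2))" for a c
  define q where "q = 1 / sqrt \<kappa>"
  have q: "0 < q" "\<kappa> * q\<^sup>2 = 1" using assms by (auto simp: q_def power_divide)
  have int: "(\<lambda>h. sin (\<kappa> * h\<^sup>2)) integrable_on {a..c}" for a c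
    by (intro integrable_continuous_interval continuous_intros)
  have F: "((\<lambda>h. sin (\<kappa> * h\<^sup>2)) has_integral I a c) {a..c}" for a c
    unfolding I_def using int by (rule integrable_integral)
  have small: "0 \<le> \<kappa> * h\<^sup>2" "\<kappa> * h\<^sup>2 \<le> 1" if "h \<in> {0..q}" for h
  proof -
    have "h\<^sup>2 \<le> q\<^sup>2" using that by (intro power_mono) auto
    then have "\<kappa> * h\<^sup>2 \<le> \<kappa> * q\<^sup>2" using assms by (intro mult_left_mono) auto
    then show "\<kappa> * h\<^sup>2 \<le> 1" using q by simp
  qed (use assms in simp)
  have large: "q / 36 \<le> I 0 H" if "q \<le> H"
  proof -
    \<comment> \<open>Up to \<open>q\<close> the integral gains \<open>5q/18\<close>, and beyond \<open>q\<close> it loses at most \<open>q/4\<close>.\<close>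
    have "((\<lambda>h. 5 / 6 * (\<kappa> * h\<^sup>2)) has_integral (5 / 18 * (\<kappa> * q ^ 3) - 5 / 18 * (\<kappa> * 0 ^ 3))) {0..q}"
      using q by (intro fundamental_theorem_of_calculus)
        (auto intro!: derivative_eq_intros simp: has_real_derivative_iff_has_vector_derivative[symmetric])
    then have "5 / 18 * (\<kappa> * q ^ 3) - 5 / 18 * (\<kappa> * 0 ^ 3) \<le> I 0 q"
      using F by (rule has_integral_le) (intro sin_ge_five_sixths small)
    moreover have "\<kappa> * q ^ 3 = q" using q by (simp add: power2_eq_square power3_eq_cube mult_ac)
    ultimately have 1: "5 / 18 * q \<le> I 0 q" by simp
    define P where "P h = (1 - cos (\<kappa> * h\<^sup>2)) / (2 * \<kappa> * h)" for h
    have "((\<lambda>h. sin (\<kappa> * h\<^sup>2) - (1 - cos (\<kappa> * h\<^sup>2)) / (2 * \<kappa> * h\<^sup>2)) has_integral P H - P q) {q..H}"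
      using that
    proof (rule fundamental_theorem_of_calculus)
      fix h assume "h \<in> {q..H}"
      then have "h \<noteq> 0" using q by auto
      then show "(P has_vector_derivative sin (\<kappa> * h\<^sup>2) - (1 - cos (\<kappa> * h\<^sup>2)) / (2 * \<kappa> * h\<^sup>2)) (at h within {q..H})"
        unfolding has_real_derivative_iff_has_vector_derivative[symmetric] P_def using assms
        by (auto intro!: derivative_eq_intros simp: field_simps power2_eq_square)
    qed
    then have 2: "P H - P q \<le> I q H"
      using F by (rule has_integral_le) (use assms in simp)
    have 3: "0 \<le> P H" using assms by (simp add: P_def)
    have "P q \<le> ((\<kappa> * q\<^sup>2)\<^sup>2 / 2) / (2 * \<kappa> * q)"
      unfolding P_def using assms q by (intro divide_right_mono one_minus_cos_le) auto
    also have "\<dots> = q / 4 * (\<kappa> * q\<^sup>2)"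
      using assms q(1) by (simp add: field_simps power2_eq_square)
    finally have 4: "P q \<le> q / 4" using q by simp
    have "I 0 q + I q H = I 0 H"
      unfolding I_def using q that by (intro Henstock_Kurzweil_Integration.integral_combine int) auto
    then show ?thesis using 1 2 3 4 by linarith
  qed
  show "1 / (36 * sqrt \<kappa>) \<le> integral {0..H} (\<lambda>h. sin (\<kappa> * h\<^sup>2))" if "1 \<le> sqrt \<kappa> * H"
    using large that assms by (simp add: I_def q_def field_simps)
  show "0 \<le> integral {0..H} (\<lambda>h. sin (\<kappa> * h\<^sup>2))"
  proof (cases "q \<le> H")
    case True
    then show ?thesis using large q(1) by (simp add: I_def)
  next
    case False
    show ?thesis
    proof (rule integral_nonneg[OF int])
      fix h assume "h \<in> {0..H}"
      then have "h \<in> {0..q}" using False by auto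
      from small[OF this] show "0 \<le> sin (\<kappa> * h\<^sup>2)"
        using pi_gt3 by (intro sin_ge_zero) auto
    qed
  qed
qed


subsection \<open>Averages of the error term\<close>

text \<open>These points are the jumps of \<open>saw (t\<^sup>2 / b)\<close>; for b = 1 they include
  the excluded points where \<open>t\<^sup>2\<close> is a natural number.\<close>

lemma finite_square_quotient_Ints:
  fixes A B b :: real
  assumes "0 \<le> A" "0 < b"
  shows "finite {t \<in> {A..B}. t\<^sup>2 / b \<in> \<int>}"
proof (rule finite_subset)
  show "{t \<in> {A..B}. t\<^sup>2 / b \<in> \<int>} \<subseteq> (\<lambda>m. sqrt (b * real_of_int m)) ` {0..\<lceil>B\<^sup>2 / b\<rceil>}"
  proof
    fix t assume "t \<in> {t \<in> {A..B}. t\<^sup>2 / b \<in> \<int>}"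
    then obtain m where t: "A \<le> t" "t \<le> B" "t\<^sup>2 / b = of_int m" by (auto elim!: Ints_cases)
    have "0 \<le> t\<^sup>2 / b" using assms by simp
    moreover have "t\<^sup>2 / b \<le> B\<^sup>2 / b"
      using t assms by (intro divide_right_mono power_mono) auto
    ultimately have "0 \<le> m" "real_of_int m \<le> B\<^sup>2 / b" unfolding t(3) by auto
    then have "m \<in> {0..\<lceil>B\<^sup>2 / b\<rceil>}" by (auto simp: le_ceiling_iff)
    moreover have "b * real_of_int m = t\<^sup>2" using t(3) assms by (simp add: field_simps)
    then have "t = sqrt (b * real_of_int m)" using t(1) assms by simp
    ultimately show "t \<in> (\<lambda>m. sqrt (b * real_of_int m)) ` {0..\<lceil>B\<^sup>2 / b\<rceil>}" by blast
  qed
qed simp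

text \<open>Integration by parts replaces \<open>saw\<close> by its continuous primitive, whose
  partial sums converge uniformly, so integrals and boundary terms pass to the limit. Positivity of
  \<open>A\<close> keeps the factor 1/t in \<open>G\<close> bounded.\<close>

lemma
  fixes A B b :: real and g g' :: "real \<Rightarrow> real"
  assumes AB: "0 < A" "A \<le> B" and b: "0 < b"
    and g: "\<And>t. (g has_real_derivative g' t) (at t)" and g': "continuous_on {A..B} g'"
  shows saw_square_integrable: "(\<lambda>t. saw (t\<^sup>2 / b) * g t) integrable_on {A..B}"
    and saw_square_integral_fourier:
      "(\<lambda>K. \<Sum>k = 1..K. integral {A..B} (\<lambda>t. sin (2 * pi * real k * (t\<^sup>2 / b)) * g t) / (pi * real k))
        \<longlonglongrightarrow> - integral {A..B} (\<lambda>t. saw (t\<^sup>2 / b) * g t)"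
proof -
  \<comment> \<open>\<open>G\<close> is \<open>g\<close> divided by the derivative 2t/b of the inner
    function.\<close>
  define G where "G t = b / (2 * t) * g t" for t
  define G' where "G' t = b / (2 * t) * g' t - b / (2 * t\<^sup>2) * g t" for t
  define S where "S = {t \<in> {A..B}. t\<^sup>2 / b \<in> \<int>}"
  have contg: "continuous_on X g" for X
    using g by (intro continuous_at_imp_continuous_on ballI DERIV_isCont)
  have G: "(G has_real_derivative G' t) (at t)" if "t \<in> {A..B}" for t
    unfolding G_def G'_def using that AB
    by (auto intro!: derivative_eq_intros g simp: field_simps power2_eq_square)
  have cG': "continuous_on {A..B} G'"
    unfolding G'_def using AB by (intro continuous_intros g' contg) auto
  have cG: "continuous_on {A..B} G"
    unfolding G_def using AB by (intro continuous_intros contg) auto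
  have der: "((\<lambda>t. F (t\<^sup>2 / b) * G t) has_vector_derivative f (t\<^sup>2 / b) * g t + F (t\<^sup>2 / b) * G' t) (at t)"
    if t: "t \<in> {A..B}" and F: "(F has_real_derivative f (t\<^sup>2 / b)) (at (t\<^sup>2 / b))" for F f t
  proof -
    have "((\<lambda>t. t\<^sup>2 / b) has_real_derivative 2 * t / b) (at t)"
      using b by (auto intro!: derivative_eq_intros)
    from DERIV_chain2[OF F this]
    have "((\<lambda>t. F (t\<^sup>2 / b)) has_real_derivative f (t\<^sup>2 / b) * (2 * t / b)) (at t)" .
    from DERIV_mult[OF this G[OF t]] show ?thesis
      unfolding has_real_derivative_iff_has_vector_derivative[symmetric]
      by (rule DERIV_cong) (use t AB b in \<open>simp add: G_def field_simps\<close>)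
  qed
  \<comment> \<open>This is used twice: for the primitive of \<open>saw\<close>, differentiable off
    the integers, and for its partial sums.\<close>
  have parts: "((\<lambda>t. f (t\<^sup>2 / b) * g t) has_integral
      (F (B\<^sup>2 / b) * G B - F (A\<^sup>2 / b) * G A) - J) {A..B}"
    if "((\<lambda>t. F (t\<^sup>2 / b) * G' t) has_integral J) {A..B}" "continuous_on UNIV F"
      "\<And>u. u \<notin> \<int> \<Longrightarrow> (F has_real_derivative f u) (at u)" for F f J
  proof -
    have "((\<lambda>t. f (t\<^sup>2 / b) * g t + F (t\<^sup>2 / b) * G' t) has_integral
        F (B\<^sup>2 / b) * G B - F (A\<^sup>2 / b) * G A) {A..B}"
    proof (rule fundamental_theorem_of_calculus_interior_strong)
      show "finite S" unfolding S_def using AB b by (intro finite_square_quotient_Ints) auto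
      show "continuous_on {A..B} (\<lambda>t. F (t\<^sup>2 / b) * G t)"
        using b by (intro continuous_intros cG continuous_on_compose2[OF that(2)]) auto
    qed (auto simp: AB S_def intro!: der that(3))
    from has_integral_diff[OF this that(1)] show ?thesis by simp
  qed
  have cont_sum: "continuous_on X (saw_primitive_sum K)" for X K
    by (auto intro!: continuous_intros simp: saw_primitive_sum_def[abs_def])
  have "uniform_limit {A..B} (\<lambda>K t. saw_primitive_sum K (t\<^sup>2 / b) * G' t)
      (\<lambda>t. saw_primitive (t\<^sup>2 / b) * G' t) sequentially"
  proof (rule uniform_lim_mult)
    show "uniform_limit {A..B} (\<lambda>K t. saw_primitive_sum K (t\<^sup>2 / b)) (\<lambda>t. saw_primitive (t\<^sup>2 / b)) sequentially"
      by (rule uniform_limit_compose'[OF uniform_limit_saw_primitive]) simp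
    show "bounded ((\<lambda>t. saw_primitive (t\<^sup>2 / b)) ` {A..B})"
      using b by (intro compact_imp_bounded compact_continuous_image
          continuous_on_compose2[OF continuous_on_saw_primitive[of UNIV]] continuous_intros) auto
    show "bounded (G' ` {A..B})"
      by (intro compact_imp_bounded compact_continuous_image cG') auto
  qed (rule uniform_limit_const)
  then obtain I J where
    I: "\<And>K. ((\<lambda>t. saw_primitive_sum K (t\<^sup>2 / b) * G' t) has_integral I K) {A..B}" and
    J: "((\<lambda>t. saw_primitive (t\<^sup>2 / b) * G' t) has_integral J) {A..B}" and IJ: "I \<longlonglongrightarrow> J"
  proof (rule uniform_limit_integral)
    show "continuous_on {A..B} (\<lambda>t. saw_primitive_sum K (t\<^sup>2 / b) * G' t)" for K
      using b by (intro continuous_intros cG' continuous_on_compose2[OF cont_sum[of UNIV]]) auto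
  qed auto
  note saw_int = parts[OF J continuous_on_saw_primitive saw_primitive_deriv]
  from saw_int show "(\<lambda>t. saw (t\<^sup>2 / b) * g t) integrable_on {A..B}" by blast
  have "(\<Sum>k = 1..K. integral {A..B} (\<lambda>t. sin (2 * pi * real k * (t\<^sup>2 / b)) * g t) / (pi * real k))
      = - ((saw_primitive_sum K (B\<^sup>2 / b) * G B - saw_primitive_sum K (A\<^sup>2 / b) * G A) - I K)" for K
  proof (rule has_integral_unique)
    have "((\<lambda>t. \<Sum>k = 1..K. sin (2 * pi * real k * (t\<^sup>2 / b)) * g t / (pi * real k)) has_integral
      (\<Sum>k = 1..K. integral {A..B} (\<lambda>t. sin (2 * pi * real k * (t\<^sup>2 / b)) * g t) / (pi * real k))) {A..B}"
      using b by (intro has_integral_sum has_integral_divide integrable_integral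
          integrable_continuous_interval continuous_intros contg) auto
    then show "((\<lambda>t. (\<Sum>k = 1..K. sin (2 * pi * real k * (t\<^sup>2 / b)) / (pi * real k)) * g t) has_integral
      (\<Sum>k = 1..K. integral {A..B} (\<lambda>t. sin (2 * pi * real k * (t\<^sup>2 / b)) * g t) / (pi * real k))) {A..B}"
      by (simp add: sum_distrib_right)
    from has_integral_neg[OF parts[OF I cont_sum saw_primitive_sum_deriv]]
    show "((\<lambda>t. (\<Sum>k = 1..K. sin (2 * pi * real k * (t\<^sup>2 / b)) / (pi * real k)) * g t) has_integral
      - ((saw_primitive_sum K (B\<^sup>2 / b) * G B - saw_primitive_sum K (A\<^sup>2 / b) * G A) - I K)) {A..B}"
      by simp
  qed
  moreover have "(\<lambda>K. saw_primitive_sum K u) \<longlonglongrightarrow> saw_primitive u" for u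
    using tendsto_uniform_limitI[OF uniform_limit_saw_primitive] by blast
  then have "(\<lambda>K. - ((saw_primitive_sum K (B\<^sup>2 / b) * G B - saw_primitive_sum K (A\<^sup>2 / b) * G A) - I K))
      \<longlonglongrightarrow> - ((saw_primitive (B\<^sup>2 / b) * G B - saw_primitive (A\<^sup>2 / b) * G A) - J)"
    by (intro tendsto_intros IJ)
  moreover note integral_unique[OF saw_int]
  ultimately show "(\<lambda>K. \<Sum>k = 1..K. integral {A..B} (\<lambda>t. sin (2 * pi * real k * (t\<^sup>2 / b)) * g t) / (pi * real k))
        \<longlonglongrightarrow> - integral {A..B} (\<lambda>t. saw (t\<^sup>2 / b) * g t)"
    by simp
qed


lemma cos_weight_deriv:
  "((\<lambda>t. \<sigma> + cos (4 * pi * t)) has_real_derivative - (4 * pi) * sin (4 * pi * t)) (at t)"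
  by (rule derivative_eq_intros refl)+ simp

text \<open>The product formula splits each Fourier term into phases with linear coefficients 0 and
  \<plusminus>4 pi. The first-derivative test bounds all of them except the resonant one, which is a
  nonnegative Fresnel integral of order sqrt b once the range is long enough. The resonance comes
  from the cosine alone, so the bound is the same for both signs of \<open>\<sigma>\<close>.\<close>

lemma saw_square_integral_upper:
  fixes b N :: nat and \<sigma> :: real
  assumes b: "1 \<le> b" "b \<le> N" and \<sigma>: "\<bar>\<sigma>\<bar> \<le> 1"
  shows "integral {real b..real N} (\<lambda>t. saw (t\<^sup>2 / b) * (\<sigma> + cos (4 * pi * t))) \<le> 2"
    and "2 * b \<le> N \<Longrightarrow>
      integral {real b..real N} (\<lambda>t. saw (t\<^sup>2 / b) * (\<sigma> + cos (4 * pi * t))) \<le> 2 - sqrt b / 1000"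
proof -
  define J where "J k = integral {real b..real N} (\<lambda>t. sin (2 * pi * real k * (t\<^sup>2 / b)) * (\<sigma> + cos (4 * pi * t)))" for k
  define R where "R \<beta> k = integral {real b..real N} (\<lambda>t. sin (2 * pi * real k / b * t\<^sup>2 + \<beta> * t))" for \<beta> k
  have R: "((\<lambda>t. sin (2 * pi * real k / b * t\<^sup>2 + \<beta> * t)) has_integral R \<beta> k) {real b..real N}" for \<beta> k
    unfolding R_def by (intro integrable_integral integrable_continuous_interval continuous_intros) (use b in simp)
  have J_eq: "J k = \<sigma> * R 0 k + (R (4 * pi) k + R (- (4 * pi)) k) / 2" for k
    unfolding J_def
  proof (rule integral_unique)
    have "((\<lambda>t. \<sigma> * sin (2 * pi * real k / b * t\<^sup>2 + 0 * t)
        + (sin (2 * pi * real k / b * t\<^sup>2 + 4 * pi * t) + sin (2 * pi * real k / b * t\<^sup>2 + - (4 * pi) * t)) / 2)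
        has_integral \<sigma> * R 0 k + (R (4 * pi) k + R (- (4 * pi)) k) / 2) {real b..real N}"
      by (intro has_integral_add has_integral_mult_right has_integral_divide R)
    moreover have "\<sigma> * sin (2 * pi * real k / b * t\<^sup>2 + 0 * t)
        + (sin (2 * pi * real k / b * t\<^sup>2 + 4 * pi * t) + sin (2 * pi * real k / b * t\<^sup>2 + - (4 * pi) * t)) / 2
      = sin (2 * pi * real k * (t\<^sup>2 / b)) * (\<sigma> + cos (4 * pi * t))" for t
    proof -
      define A where "A = 2 * pi * real k / b * t\<^sup>2"
      have A: "2 * pi * real k * (t\<^sup>2 / b) = A" by (simp add: A_def)
      show ?thesis
        unfolding A A_def[symmetric] using sin_times_cos[of A "4 * pi * t"]
        by (simp add: distrib_left mult.commute[of "sin A"])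
    qed
    ultimately show "((\<lambda>t. sin (2 * pi * real k * (t\<^sup>2 / b)) * (\<sigma> + cos (4 * pi * t)))
        has_integral \<sigma> * R 0 k + (R (4 * pi) k + R (- (4 * pi)) k) / 2) {real b..real N}"
      by (simp only:)
  qed
  \<comment> \<open>The denominator is the derivative of the phase at the left end point t =
    b.\<close>
  have R_le: "\<bar>R \<beta> k\<bar> \<le> 2 / (4 * pi * real k + \<beta>)" if "0 < 4 * pi * real k + \<beta>" for \<beta> k
    using integral_sin_quadratic_bound[of "2 * pi * real k / b" "real b" "real N" \<beta>] that b
    by (simp add: R_def mult.assoc)
  have R0: "\<bar>\<sigma> * R 0 k\<bar> \<le> 1 / (pi * real k) / 2" if "1 \<le> k" for k
  proof -
    have "\<bar>\<sigma> * R 0 k\<bar> \<le> 1 * \<bar>R 0 k\<bar>"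
      unfolding abs_mult using \<sigma> by (intro mult_right_mono) auto
    also have "\<dots> \<le> 1 / (pi * real k) / 2" using R_le[of k 0] that by simp
    finally show ?thesis .
  qed
  have Rp: "\<bar>R (4 * pi) k\<bar> \<le> 1 / (pi * real k) / 2" if "1 \<le> k" for k
  proof -
    have "\<bar>R (4 * pi) k\<bar> \<le> 2 / (4 * pi * real k + 4 * pi)"
      by (intro R_le add_nonneg_pos) auto
    also have "\<dots> \<le> 2 / (4 * pi * real k)"
      using that by (intro divide_left_mono) (auto intro!: mult_pos_pos add_nonneg_pos)
    finally show ?thesis by simp
  qed
  \<comment> \<open>For k \<ge> 2 the linear term removes at most half of the phase derivative 4 pi
    k.\<close>
  have Rm: "\<bar>R (- (4 * pi)) k\<bar> \<le> 1 / (pi * real k)" if "2 \<le> k" for k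
  proof -
    have "2 * pi * 2 \<le> 2 * pi * real k" using that by (intro mult_left_mono) auto
    then have *: "2 * (pi * real k) \<le> 4 * pi * real k + - (4 * pi)" by linarith
    have "0 < 2 * (pi * real k)" using that by simp
    then have "0 < 4 * pi * real k + - (4 * pi)" using * by linarith
    then have "\<bar>R (- (4 * pi)) k\<bar> \<le> 2 / (4 * pi * real k + - (4 * pi))" by (rule R_le)
    also have "\<dots> \<le> 2 / (2 * (pi * real k))"
      using * \<open>0 < 2 * (pi * real k)\<close> \<open>0 < 4 * pi * real k + - (4 * pi)\<close>
      by (intro divide_left_mono mult_pos_pos) auto
    finally show ?thesis by simp
  qed
  \<comment> \<open>The resonant term, the only one whose phase is stationary.\<close>
  define P where "P = R (- (4 * pi)) 1"
  have J1: "P / (2 * pi) - 1 \<le> J 1 / pi"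
  proof -
    define x where "x = 1 / (pi * real 1)"
    have x: "x \<le> 1" using pi_gt3 by (simp add: x_def)
    have "c / 2 - 1 \<le> a + (b + c) / 2" if "\<bar>a\<bar> \<le> x / 2" "\<bar>b\<bar> \<le> x / 2" for a b c :: real
      using that x by argo
    then have "P / 2 - 1 \<le> J 1"
      using R0[OF order_refl, folded x_def] Rp[OF order_refl, folded x_def] unfolding J_eq P_def by blast
    then have "(P / 2 - 1) * x \<le> J 1 * x"
      by (intro mult_right_mono) (auto simp: x_def)
    moreover have "P / (2 * pi) = P / 2 * x" "J 1 / pi = J 1 * x" by (simp_all add: x_def)
    ultimately show ?thesis using x unfolding left_diff_distrib by argo
  qed
  have Jk: "- (1 / (real k)\<^sup>2) \<le> J k / (pi * real k)" if "2 \<le> k" for k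
  proof -
    define x where "x = 1 / (pi * real k)"
    have x: "0 \<le> x" by (simp add: x_def)
    have k1: "1 \<le> k" using that by simp
    have "\<bar>a + (b + c) / 2\<bar> \<le> 3 * x" if "\<bar>a\<bar> \<le> x / 2" "\<bar>b\<bar> \<le> x / 2" "\<bar>c\<bar> \<le> x" for a b c :: real
      using that x by argo
    then have "\<bar>J k\<bar> \<le> 3 * x"
      using R0[OF k1] Rp[OF k1] Rm[OF that] unfolding J_eq x_def[symmetric] by blast
    also have "\<dots> \<le> pi * x" using x pi_gt3 by (intro mult_right_mono) auto
    also have "\<dots> = 1 / real k" using that by (simp add: x_def)
    finally have "\<bar>J k\<bar> \<le> 1 / real k" .
    then have "\<bar>J k\<bar> / (pi * real k) \<le> 1 / real k / (pi * real k)"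
      by (rule divide_right_mono) simp
    also have "\<dots> \<le> 1 / real k / (1 * real k)"
      using that pi_gt3 by (intro divide_left_mono mult_right_mono) auto
    also have "\<dots> = 1 / (real k)\<^sup>2" by (simp add: power2_eq_square)
    finally have "\<bar>J k / (pi * real k)\<bar> \<le> 1 / (real k)\<^sup>2" by (simp add: abs_mult)
    from abs_le_D2[OF this] show ?thesis by (subst minus_le_iff)
  qed
  \<comment> \<open>The losses 1/k^2 are dominated by the telescoping 1/(k-1) - 1/k; the summand 1/K
    carries the induction. The term k = 1 loses 1 and all later ones together at most 1.\<close>
  have partial: "P / (2 * pi) - 2 + 1 / real K \<le> (\<Sum>k = 1..K. J k / (pi * real k))" if "1 \<le> K" for K
    using that
  proof (induction K rule: nat_induct_at_least)
    case base
    then show ?case using J1 by simp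
  next
    case (Suc K)
    have "1 / (real (Suc K))\<^sup>2 \<le> 1 / real K - 1 / real (Suc K)"
      using Suc.hyps by (simp add: divide_simps power2_eq_square)
    moreover have "- (1 / (real (Suc K))\<^sup>2) \<le> J (Suc K) / (pi * real (Suc K))"
      using Suc.hyps by (intro Jk) simp
    moreover have "(\<Sum>k = 1..Suc K. J k / (pi * real k))
        = (\<Sum>k = 1..K. J k / (pi * real k)) + J (Suc K) / (pi * real (Suc K))"
      by simp
    ultimately show ?case using Suc.IH by linarith
  qed
  have "(\<lambda>K. \<Sum>k = 1..K. J k / (pi * real k)) \<longlonglongrightarrow>
      - integral {real b..real N} (\<lambda>t. saw (t\<^sup>2 / b) * (\<sigma> + cos (4 * pi * t)))"
    unfolding J_def
    using b by (intro saw_square_integral_fourier[OF _ _ _ cos_weight_deriv] continuous_intros) auto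
  then have "P / (2 * pi) - 2 \<le> - integral {real b..real N} (\<lambda>t. saw (t\<^sup>2 / b) * (\<sigma> + cos (4 * pi * t)))"
  proof (rule LIMSEQ_le_const)
    have "P / (2 * pi) - 2 \<le> (\<Sum>k = 1..K. J k / (pi * real k))" if "1 \<le> K" for K
    proof -
      have "0 \<le> 1 / real K" by simp
      with partial[OF that] show ?thesis by linarith
    qed
    then show "\<exists>N. \<forall>n\<ge>N. P / (2 * pi) - 2 \<le> (\<Sum>k = 1..n. J k / (pi * real k))" by blast
  qed
  then have main: "integral {real b..real N} (\<lambda>t. saw (t\<^sup>2 / b) * (\<sigma> + cos (4 * pi * t))) \<le> 2 - P / (2 * pi)"
    by simp
  \<comment> \<open>Shifting by \<open>b\<close> completes the square; the leftover constant 2 pi b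
    is a multiple of 2 pi because \<open>b\<close> is a natural number.\<close>
  have "P = integral {0 + real b..real (N - b) + real b} (\<lambda>t. sin (2 * pi / b * t\<^sup>2 + - (4 * pi) * t))"
    using b by (simp add: P_def R_def)
  also have "\<dots> = integral {0..real (N - b)} ((\<lambda>t. sin (2 * pi / b * t\<^sup>2 + - (4 * pi) * t)) \<circ> ((+) (real b)))"
    by (rule integral_shift_Icc_real[symmetric])
  also have "(\<lambda>t. sin (2 * pi / b * t\<^sup>2 + - (4 * pi) * t)) \<circ> ((+) (real b)) = (\<lambda>h. sin (2 * pi / b * h\<^sup>2))"
  proof
    fix h :: real
    have "2 * pi / b * (b + h)\<^sup>2 + - (4 * pi) * (b + h) = 2 * pi / b * h\<^sup>2 - 2 * real b * pi"
      using b by (simp add: field_simps power2_eq_square)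
    moreover have "sin (y - 2 * real b * pi) = sin y" for y
      using sin_2npi[of b] cos_2npi[of b] by (simp add: sin_diff)
    ultimately show "((\<lambda>t. sin (2 * pi / b * t\<^sup>2 + - (4 * pi) * t)) \<circ> ((+) (real b))) h = sin (2 * pi / b * h\<^sup>2)"
      unfolding comp_def by (simp only:)
  qed
  finally have P_eq: "P = integral {0..real (N - b)} (\<lambda>h. sin (2 * pi / b * h\<^sup>2))" .
  have \<kappa>: "0 < 2 * pi / b" using b by simp
  have "0 \<le> P" unfolding P_eq by (rule integral_sin_square_lower(1)[OF \<kappa>]) simp
  then have "0 \<le> P / (2 * pi)" by simp
  with main show "integral {real b..real N} (\<lambda>t. saw (t\<^sup>2 / b) * (\<sigma> + cos (4 * pi * t))) \<le> 2"
    by linarith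
  assume N: "2 * b \<le> N"
  \<comment> \<open>The range has length at least \<open>b\<close>, so it reaches the Fresnel scale
    sqrt(b/(2 pi)).\<close>
  have "sqrt (2 * pi / b) * real (N - b) \<ge> sqrt (2 * pi / b) * b"
    using N by (intro mult_left_mono) auto
  moreover have "1 \<le> sqrt (2 * pi / b) * b"
  proof -
    have "1 * 1 \<le> 2 * pi * b" using b pi_gt3 by (intro mult_mono) auto
    then have "1 \<le> sqrt (2 * pi * b)" by simp
    also have "2 * pi * b = 2 * pi / b * b\<^sup>2" using b by (simp add: power2_eq_square)
    finally show ?thesis unfolding real_sqrt_mult by simp
  qed
  ultimately have "1 \<le> sqrt (2 * pi / b) * real (N - b)" by (rule order_trans[rotated])
  then have "1 / (36 * sqrt (2 * pi / b)) \<le> P"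
    unfolding P_eq by (rule integral_sin_square_lower(2)[OF \<kappa> of_nat_0_le_iff])
  moreover have "sqrt b / 108 \<le> 1 / (36 * sqrt (2 * pi / b))"
  proof -
    have "sqrt (2 * pi) \<le> 3" using pi_less_4 by (intro real_le_lsqrt) auto
    then have "sqrt b * sqrt (2 * pi) \<le> sqrt b * 3" by (intro mult_left_mono) auto
    moreover have "0 < sqrt (2 * pi)" by simp
    ultimately show ?thesis
      unfolding real_sqrt_divide using b by (simp only: divide_simps) (auto simp: mult_ac)
  qed
  ultimately have P: "sqrt b / 108 \<le> P" by linarith
  \<comment> \<open>108 is 36 * 3, from sqrt(2 pi) \<le> 3, and 8 bounds 2 pi.\<close>
  have "sqrt b / 1000 \<le> (sqrt b / 108) / 8" by simp
  also have "\<dots> \<le> P / (2 * pi)"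
    using P \<open>0 \<le> P\<close> pi_less_4 by (intro frac_le) auto
  finally show "integral {real b..real N} (\<lambda>t. saw (t\<^sup>2 / b) * (\<sigma> + cos (4 * pi * t))) \<le> 2 - sqrt b / 1000"
    using main by linarith
qed

text \<open>Exchanging sum and integral confines the term \<open>b\<close> to t \<ge> b. The
  \<open>M\<close> values of \<open>b\<close> in \<open>{M<..2 * M}\<close> satisfy 2b \<le> 4M and
  sqrt b \<ge> sqrt M, so each supplies the saving sqrt M/1000; every \<open>b\<close> up to 4M
  costs at most 2.\<close>

lemma saw_sum_integral_upper:
  fixes M :: nat and \<sigma> :: real
  assumes \<sigma>: "\<bar>\<sigma>\<bar> \<le> 1"
  obtains I where "((\<lambda>t. saw_sum t * (\<sigma> + cos (4 * pi * t))) has_integral I) {1..real (4 * M)}"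
    and "I \<le> 8 * real M - real M * sqrt M / 1000"
proof -
  define N where "N = 4 * M"
  define f where "f b t = saw (t\<^sup>2 / real b) * (\<sigma> + cos (4 * pi * t))" for b t
  define I where "I b = integral {real b..real N} (f b)" for b
  have "((\<lambda>t. if t \<in> {real b..real N} then f b t else 0) has_integral I b) {1..real N}"
    if "b \<in> {1..N}" for b
  proof -
    have "f b integrable_on {real b..real N}"
      unfolding f_def using that
      by (intro saw_square_integrable[OF _ _ _ cos_weight_deriv] continuous_intros) auto
    then have "(f b has_integral I b) {real b..real N}"
      unfolding I_def by (rule integrable_integral)
    then show ?thesis using that by (subst has_integral_restrict) auto
  qed
  then have "((\<lambda>t. \<Sum>b = 1..N. if t \<in> {real b..real N} then f b t else 0) has_integral (\<Sum>b = 1..N. I b)) {1..real N}"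
    by (intro has_integral_sum) auto
  then have int: "((\<lambda>t. saw_sum t * (\<sigma> + cos (4 * pi * t))) has_integral (\<Sum>b = 1..N. I b)) {1..real N}"
  proof (rule has_integral_eq[rotated])
    fix t assume t: "t \<in> {1..real N}"
    have "(\<Sum>b = 1..N. if t \<in> {real b..real N} then f b t else 0)
        = (\<Sum>b \<in> {b \<in> {1..N}. t \<in> {real b..real N}}. f b t)"
      by (rule sum.inter_filter[symmetric]) simp
    also have "{b \<in> {1..N}. t \<in> {real b..real N}} = {1..nat \<lfloor>t\<rfloor>}"
      using t by (auto simp: le_nat_iff le_floor_iff)
    finally show "(\<Sum>b = 1..N. if t \<in> {real b..real N} then f b t else 0) = saw_sum t * (\<sigma> + cos (4 * pi * t))"
      by (simp add: saw_sum_def f_def sum_distrib_right)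
  qed
  have "I b \<le> 2 - (if b \<in> {M<..2 * M} then sqrt M / 1000 else 0)" if "b \<in> {1..N}" for b
  proof (cases "b \<in> {M<..2 * M}")
    case True
    then have "I b \<le> 2 - sqrt b / 1000"
      unfolding I_def f_def using that \<sigma> by (intro saw_square_integral_upper(2)) (auto simp: N_def)
    moreover have "sqrt M \<le> sqrt b" using True by simp
    ultimately have "I b \<le> 2 - sqrt M / 1000" by linarith
    then show ?thesis using True by simp
  next
    case False
    have "I b \<le> 2"
      unfolding I_def f_def using that \<sigma> by (intro saw_square_integral_upper(1)) auto
    then show ?thesis unfolding if_not_P[OF False] by simp
  qed
  then have "(\<Sum>b = 1..N. I b) \<le> (\<Sum>b = 1..N. 2 - (if b \<in> {M<..2 * M} then sqrt M / 1000 else 0))"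
    by (rule sum_mono)
  also have "\<dots> = 2 * real N - (\<Sum>b \<in> {1..N} \<inter> {M<..2 * M}. sqrt M / 1000)"
    unfolding sum_subtractf sum.inter_restrict[OF finite_atLeastAtMost] by simp
  also have "{1..N} \<inter> {M<..2 * M} = {M<..2 * M}" by (auto simp: N_def)
  finally have "(\<Sum>b = 1..N. I b) \<le> 8 * real M - real M * sqrt M / 1000"
    by (simp add: N_def)
  with int show thesis unfolding N_def by (rule that)
qed

section \<open>From averages to large values of either sign\<close>

text \<open>This trivial bound later turns a large value of the sum into a large
  \<open>t\<close>.\<close>

lemma abs_saw_sum_le:
  assumes "0 \<le> t"
  shows "\<bar>2 * saw_sum t\<bar> \<le> t"
proof -
  have "\<bar>saw_sum t\<bar> \<le> (\<Sum>b = 1..nat \<lfloor>t\<rfloor>. 1 / 2)"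
    unfolding saw_sum_def by (rule order_trans[OF sum_abs]) (intro sum_mono abs_saw_le)
  also have "\<dots> \<le> t / 2" using assms by simp
  finally show ?thesis by simp
qed

text \<open>A one-sided bound, integrated against the nonnegative weight, would allow at most sqrt
  M/2000 + O(1) per unit of \<open>M\<close>, whereas the average forces sqrt M/1000 - 8. The free
  constant \<open>C\<close> serves to absorb bounded errors and to push \<open>t\<close>
  upwards.\<close>

lemma saw_sum_unbounded:
  fixes \<sigma> C :: real
  assumes \<sigma>: "\<sigma> = 1 \<or> \<sigma> = - 1"
  obtains t where "1 \<le> t" "t\<^sup>2 \<notin> \<nat>" "sqrt t / 16000 + C < - (2 * \<sigma> * saw_sum t)"
proof (rule ccontr)
  note found = that
  assume no: "\<not> thesis"
  define C' where "C' = max C 0"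
  have upper: "- (2 * \<sigma> * saw_sum t) \<le> sqrt t / 16000 + C'" if "1 \<le> t" "t\<^sup>2 \<notin> \<nat>" for t
  proof (rule ccontr)
    assume "\<not> ?thesis"
    then have "sqrt t / 16000 + C < - (2 * \<sigma> * saw_sum t)" unfolding C'_def by linarith
    with no found that show False by blast
  qed
  \<comment> \<open>This makes sqrt M/2000 at least 9 + 4C', beating the 8 + 4C' left at the
    end.\<close>
  define M where "M = nat \<lceil>(2000 * (9 + 4 * C'))\<^sup>2\<rceil>"
  have C': "0 \<le> C'" by (simp add: C'_def)
  have "(2000 * (9 + 4 * C'))\<^sup>2 \<le> real M" unfolding M_def by (rule real_nat_ceiling_ge)
  then have sM: "2000 * (9 + 4 * C') \<le> sqrt M" by (rule real_le_rsqrt)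
  moreover have "0 < 2000 * (9 + 4 * C')" using C' by simp
  ultimately have "0 < sqrt M" by (rule order.strict_trans2[rotated])
  then have M: "0 < real M" by simp
  have "\<bar>\<sigma>\<bar> \<le> 1" using \<sigma> by auto
  then obtain I where I: "((\<lambda>t. saw_sum t * (\<sigma> + cos (4 * pi * t))) has_integral I) {1..real (4 * M)}"
    and I_le: "I \<le> 8 * real M - real M * sqrt M / 1000"
    by (rule saw_sum_integral_upper)
  define S where "S = {t \<in> {1..real (4 * M)}. t\<^sup>2 / 1 \<in> \<int>}"
  define B where "B = 2 * sqrt M / 16000 + C'"
  have B: "0 \<le> B" using C' by (simp add: B_def)
  have "finite S" unfolding S_def by (intro finite_square_quotient_Ints) auto
  \<comment> \<open>The assumed bound says nothing where \<open>t\<^sup>2\<close> is a natural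
    number; changing the integrand on the finite set \<open>S\<close> keeps the integral.\<close>
  then have "((\<lambda>t. if t \<in> S then 0 else - (saw_sum t * (\<sigma> + cos (4 * pi * t)))) has_integral - I) {1..real (4 * M)}"
    by (rule has_integral_spike_finite[OF _ _ has_integral_neg[OF I]]) auto
  moreover have "((\<lambda>_. B) has_integral (4 * real M - 1) * B) {1..real (4 * M)}"
    using has_integral_const_real[of B 1 "real (4 * M)"] M by simp
  ultimately have "- I \<le> (4 * real M - 1) * B"
  proof (rule has_integral_le)
    fix t assume t: "t \<in> {1..real (4 * M)}"
    show "(if t \<in> S then 0 else - (saw_sum t * (\<sigma> + cos (4 * pi * t)))) \<le> B"
    proof (cases "t \<in> S")
      case False
      have "t\<^sup>2 \<notin> \<nat>" using False t Nats_subset_Ints unfolding S_def by auto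
      then have "- (2 * \<sigma> * saw_sum t) \<le> sqrt t / 16000 + C'" using t by (intro upper) auto
      also have "sqrt t \<le> sqrt (4 * M)" using t by simp
      also have "sqrt (4 * M) = 2 * sqrt M" by (simp add: real_sqrt_mult)
      finally have s: "- (2 * \<sigma> * saw_sum t) \<le> B" by (simp add: B_def)
      \<comment> \<open>As \<sigma>^2 = 1, the weight \<open>\<sigma> + cos (4 * pi * t)\<close>
        equals 2 \<sigma> c with c between 0 and 1.\<close>
      define c where "c = (1 + \<sigma> * cos (4 * pi * t)) / 2"
      have c: "0 \<le> c" "c \<le> 1"
        using \<sigma> cos_ge_minus_one[of "4 * pi * t"] cos_le_one[of "4 * pi * t"]
        unfolding c_def by (elim disjE; simp; argo)+
      have "- (saw_sum t * (\<sigma> + cos (4 * pi * t))) = - (2 * \<sigma> * saw_sum t) * c"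
        using \<sigma> unfolding c_def by (auto simp: algebra_simps)
      also have "\<dots> \<le> B * c" using s c by (intro mult_right_mono)
      also have "\<dots> \<le> B" using B c mult_left_le by blast
      finally show ?thesis using False by simp
    qed (use B in simp)
  qed
  also have "\<dots> \<le> (4 * real M) * B"
    using B by (intro mult_right_mono) auto
  finally have "real M * sqrt M / 1000 - 8 * real M \<le> 4 * real M * B" using I_le by argo
  then have "real M * (sqrt M / 1000 - 8) \<le> real M * (4 * B)" by (simp add: algebra_simps)
  then have "sqrt M / 1000 - 8 \<le> 4 * B" using M by (simp only: mult_le_cancel_left_pos)
  then show False using sM C' unfolding B_def by argo
qed

text \<open>Put x = t^2, so that x^(1/4) = sqrt t. In the constant 10 + |X|, the 10 covers the
  hyperbola error 8 and pi^2/12, while |X| forces t \<ge> X through the trivial bound.\<close>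

lemma divisor_error_unbounded:
  fixes \<sigma> X :: real
  assumes \<sigma>: "\<sigma> = 1 \<or> \<sigma> = - 1"
  obtains x where "X \<le> x" "x \<notin> \<nat>"
    "1 / 16000 < \<sigma> * ((divisor_summatory x
      - (- (pi\<^sup>2 / 12) + (ln x + 2 * euler_mascheroni - 1) * x)) / x powr (1 / 4))"
proof -
  obtain t where t: "1 \<le> t" "t\<^sup>2 \<notin> \<nat>" and
    lower: "sqrt t / 16000 + (10 + \<bar>X\<bar>) < - (2 * \<sigma> * saw_sum t)"
    using saw_sum_unbounded[OF \<sigma>] by blast
  have "- (2 * \<sigma> * saw_sum t) \<le> t" using abs_saw_sum_le[of t] \<sigma> t by auto
  moreover have "0 \<le> sqrt t" using t by simp
  ultimately have "X \<le> t" using lower by linarith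
  also have "t \<le> t\<^sup>2" using t by (simp add: power2_eq_square)
  finally have X: "X \<le> t\<^sup>2" .
  define f where "f = divisor_summatory (t\<^sup>2) - (- (pi\<^sup>2 / 12) + (ln (t\<^sup>2) + 2 * euler_mascheroni - 1) * t\<^sup>2)"
  have "pi\<^sup>2 \<le> 4\<^sup>2" using pi_less_4 by (intro power_mono) auto
  then have "pi\<^sup>2 \<le> 16" by simp
  moreover have "\<bar>f - pi\<^sup>2 / 12 + 2 * saw_sum t\<bar> \<le> 8"
    using divisor_summatory_saw_sum[OF t(1)] by (simp add: f_def)
  moreover have "0 \<le> pi\<^sup>2" by simp
  ultimately have "\<bar>f + 2 * saw_sum t\<bar> \<le> 10" by linarith
  then have "- (2 * \<sigma> * saw_sum t) - 10 \<le> \<sigma> * f"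
    using \<sigma> by (elim disjE) (simp_all add: abs_le_iff)
  then have "sqrt t / 16000 < \<sigma> * f" using lower by linarith
  moreover have "(t\<^sup>2) powr (1 / 4) = sqrt t"
    using t by (simp add: powr_half_sqrt[symmetric] powr_powr flip: powr_numeral)
  ultimately have "1 / 16000 < \<sigma> * (f / (t\<^sup>2) powr (1 / 4))"
    using t by (simp add: pos_less_divide_eq)
  with X t(2) show thesis unfolding f_def by (rule that)
qed

subsection \<open>The omega theorem\<close>

theorem theorem1p3:
  shows "Omega_pm at_top_non_nat
           (\<lambda>x. divisor_summatory x
                  - (- (pi\<^sup>2 / 12) + (ln x + 2 * euler_mascheroni - 1) * x))
           (\<lambda>x. x powr (1 / 4))"
proof -
  define q where "q x = (divisor_summatory x
      - (- (pi\<^sup>2 / 12) + (ln x + 2 * euler_mascheroni - 1) * x)) / x powr (1 / 4)" for x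
  have not_ev: "\<not> eventually P at_top_non_nat"
    if "\<And>X. \<exists>x\<ge>X. x \<notin> \<nat> \<and> \<not> P x" for P :: "real \<Rightarrow> bool"
    using that unfolding at_top_non_nat_def eventually_inf_principal eventually_at_top_linorder by auto
  \<comment> \<open>The fixed gap 1/16000 matters: positive values at arbitrarily large
    \<open>x\<close> alone would only give a limsup \<ge> 0.\<close>
  have "0 < Limsup at_top_non_nat (\<lambda>x. ereal (q x))"
  proof (rule ccontr)
    assume "\<not> ?thesis"
    then have "Limsup at_top_non_nat (\<lambda>x. ereal (q x)) < ereal (1 / 16000)"
      by (simp add: not_less le_less_trans)
    then have "eventually (\<lambda>x. ereal (q x) < ereal (1 / 16000)) at_top_non_nat"
      by (rule Limsup_lessD)
    moreover have "\<not> eventually (\<lambda>x. ereal (q x) < ereal (1 / 16000)) at_top_non_nat"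
    proof (rule not_ev)
      fix X
      obtain x where "X \<le> x" "x \<notin> \<nat>" "1 / 16000 < 1 * q x"
        using divisor_error_unbounded[OF disjI1[OF refl], folded q_def] .
      then show "\<exists>x\<ge>X. x \<notin> \<nat> \<and> \<not> ereal (q x) < ereal (1 / 16000)"
        by (intro exI[of _ x]) auto
    qed
    ultimately show False by contradiction
  qed
  moreover have "Liminf at_top_non_nat (\<lambda>x. ereal (q x)) < 0"
  proof (rule ccontr)
    assume "\<not> ?thesis"
    then have "ereal (- (1 / 16000)) < Liminf at_top_non_nat (\<lambda>x. ereal (q x))"
      by (simp add: not_less less_le_trans[of _ 0])
    then have "eventually (\<lambda>x. ereal (- (1 / 16000)) < ereal (q x)) at_top_non_nat"
      by (rule less_LiminfD)
    moreover have "\<not> eventually (\<lambda>x. ereal (- (1 / 16000)) < ereal (q x)) at_top_non_nat"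
    proof (rule not_ev)
      fix X
      obtain x where "X \<le> x" "x \<notin> \<nat>" "1 / 16000 < - 1 * q x"
        using divisor_error_unbounded[OF disjI2[OF refl], folded q_def] .
      then show "\<exists>x\<ge>X. x \<notin> \<nat> \<and> \<not> ereal (- (1 / 16000)) < ereal (q x)"
        by (intro exI[of _ x]) auto
    qed
    ultimately show False by contradiction
  qed
  ultimately show ?thesis unfolding Omega_pm_def q_def by blast
qed

end
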